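(* Let $\{\hat a(x,y) : x\le y,\ x,y\in\mathbb N\}$ be jointly independent random variables, each equal to $1$ with probability $1/2$ and to $-1$ with probability $1/2$, extended by $\hat a(y,x)=\hat a(x,y)$, and let $\hat A_N^{(p)}$ be the dilute random matrix with parameter $p=p_N\le N$ built from the $\hat a(x,y)$ (see context). Let $\delta\in(0,1)$ and let $N,p\to\infty$ in such a way that $$\frac{p}{(\log N)^{1-\delta}}\to 0 .$$ Then for any given $R>0$, $$\lim_{N,p\to\infty}(\mu_a\otimes\mu_d)\left\{\|\hat A_N^{(p)}\|>R\right\}=1 .$$
   Context: For each $N$ and $0<p\le N$ let $\{d_N(x,y) : 1\le x\le y\le N\}$ be independent random variables, also independent of the family $\{\hat a(x,y)\}$, with $d_N(x,y)=1$ with probability $p/N$ and $d_N(x,y)=0$ with probability $1-p/N$; put $d_N(y,x)=d_N(x,y)$. The matrix $\hat A_N^{(p)}$ is the $N\times N$ real symmetric matrix with entries $$\hat A_N^{(p)}(x,y)=\frac{1}{\sqrt p}\,\hat a(x,y)\,d_N(x,y),\qquad x,y=1,\dots,N .$$ $\mu_a$ denotes the probability measure of the family $\{\hat a(x,y)\}$ and $\mu_d$ that of the family $\{d_N(x,y)\}$; $\mu_a\otimes\mu_d$ is the product measure. $\|\cdot\|$ is the spectral norm, i.e. the maximum of the absolute values of the eigenvalues. *)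

theory Defs
  imports "HOL-Probability.Probability" "Jordan_Normal_Form.Spectral_Radius"
begin

(* Matrix indices of Jordan_Normal_Form start at 0, while x, y range over 1..N. *)
definition dilute_matrix ::
  "nat \<Rightarrow> real \<Rightarrow> (nat \<Rightarrow> nat \<Rightarrow> real) \<Rightarrow> (nat \<Rightarrow> nat \<Rightarrow> real) \<Rightarrow> real mat" where
  "dilute_matrix N p a d =
     mat N N (\<lambda>(i, j). 1 / sqrt p * a (i + 1) (j + 1) * d (i + 1) (j + 1))"

(* The maximum of the absolute values of the eigenvalues. Eigenvalues are taken in the complex
   numbers because spectral_radius is defined for complex matrices; for a real symmetric matrix
   they are all real. As in spectral_radius, the value for a 0 x 0 matrix is unspecified. *)
definition spectral_norm :: "real mat \<Rightarrow> real" where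
  "spectral_norm A = spectral_radius (map_mat complex_of_real A)"

end

theory Submission
  imports Defs "HOL-Real_Asymp.Real_Asymp"
begin

text \<open>Since \<open>a(x,y)\<^sup>2 = 1\<close>, the diagonal entry \<open>(A\<^sup>2)(x,x)\<close> of the dilute matrix is the degree of \<open>x\<close>
  in the random graph \<open>d\<close> divided by \<open>p\<close>, and it is a lower bound for the square of the spectral norm.
  Hence it suffices that some vertex has degree more than \<open>R\<^sup>2 p\<close>. To have independent
  degrees, count only the edges between \<open>x \<le> N/2\<close> and \<open>y > N/2\<close>. Divide the range of \<open>y\<close> into about
  \<open>R\<^sup>2 p\<close> blocks of length of order \<open>N / p\<close>: each of them contains a neighbour of \<open>x\<close> with probability at
  least a constant \<open>c > 0\<close>, so \<open>x\<close> has the desired degree with probability at least \<open>c\<close> to the power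
  \<open>O(p)\<close>. As \<open>p = o(ln N)\<close>, this is much larger than \<open>1 / N\<close>, and the \<open>N/2\<close> independent trials make
  success almost certain.\<close>

subsection \<open>Spectral norm and powers of matrices\<close>

lemma index_mult_mat_sum:
  assumes "A \<in> carrier_mat n n" "B \<in> carrier_mat n n" "i < n" "j < n"
  shows "(A * B) $$ (i, j) = (\<Sum>l<n. A $$ (i, l) * B $$ (l, j))"
  using assms by (auto simp: scalar_prod_def atLeast0LessThan intro!: sum.cong)

lemma pow_mat_add:
  assumes A: "A \<in> carrier_mat n n"
  shows "A ^\<^sub>m (k + l) = A ^\<^sub>m k * A ^\<^sub>m l"
proof (induction l)
  case 0
  then show ?case using A by simp
next
  case (Suc l)
  then show ?case
    using A assoc_mult_mat[of "A ^\<^sub>m k" n n "A ^\<^sub>m l" n A n] by simp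
qed

lemma smult_pow_mat:
  fixes A :: "'a :: comm_ring_1 mat"
  assumes A: "A \<in> carrier_mat n n"
  shows "(c \<cdot>\<^sub>m A) ^\<^sub>m k = c ^ k \<cdot>\<^sub>m A ^\<^sub>m k"
proof (induction k)
  case 0
  show ?case using A by (intro eq_matI) simp_all
next
  case (Suc k)
  have "(c \<cdot>\<^sub>m A) ^\<^sub>m Suc k = (c ^ k \<cdot>\<^sub>m A ^\<^sub>m k) * (c \<cdot>\<^sub>m A)"
    by (simp add: Suc)
  also have "\<dots> = c ^ Suc k \<cdot>\<^sub>m (A ^\<^sub>m k * A)"
    using A by (intro eq_matI) (auto simp: index_mult_mat_sum[of _ n] sum_distrib_left mult_ac
        simp del: index_mult_mat(1) intro!: sum.cong)
  finally show ?case by simp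
qed

text \<open>Dividing by \<open>r\<close> brings the spectral radius below 1, where the Jordan normal
  form keeps all powers bounded; scaling back multiplies the bound by \<open>r ^ k\<close>.\<close>

lemma norm_bound_pow_mat:
  fixes A :: "complex mat"
  assumes A: "A \<in> carrier_mat n n" and n: "n > 0"
    and less: "spectral_radius A < r" and r: "0 < r"
  obtains c where "\<And>k. norm_bound (A ^\<^sub>m k) (c * r ^ k)"
proof -
  define B where "B = complex_of_real (1 / r) \<cdot>\<^sub>m A"
  have B: "B \<in> carrier_mat n n" using A by (simp add: B_def)
  have AB: "A = complex_of_real r \<cdot>\<^sub>m B"
    using r by (auto simp: B_def intro!: eq_matI)
  from spectral_radius_mem_max(1)[OF B n] obtain e
    where e: "eigenvalue B e" and norm_e: "spectral_radius B = norm e"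
    by (auto simp: spectrum_def)
  then obtain v where v: "v \<in> carrier_vec n" "v \<noteq> 0\<^sub>v n" "B *\<^sub>v v = e \<cdot>\<^sub>v v"
    using B by (auto simp: eigenvalue_def eigenvector_def)
  have "A *\<^sub>v v = complex_of_real r \<cdot>\<^sub>v (B *\<^sub>v v)"
    using v(1) B by (auto simp: AB scalar_prod_def sum_distrib_left mult_ac intro!: eq_vecI sum.cong)
  then have "A *\<^sub>v v = (r * e) \<cdot>\<^sub>v v"
    by (simp add: v(3) smult_smult_assoc)
  \<comment> \<open>An eigenvalue of \<open>B\<close> of maximal modulus, scaled by
    \<open>r\<close>, is an eigenvalue of \<open>A\<close>. Hence the spectral radius of
    \<open>B\<close> is at most that of \<open>A\<close> divided by \<open>r\<close>.\<close>
  then have "eigenvalue A (r * e)"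
    using v A by (auto simp: eigenvalue_def eigenvector_def)
  then have "r * norm e \<le> spectral_radius A"
    using spectral_radius_mem_max(2)[OF A n, of "norm (r * e)"] r
    by (simp add: spectrum_def norm_mult image_iff) (metis abs_of_pos norm_mult norm_of_real)
  then have "r * norm e < r * 1" using less by simp
  then have "spectral_radius B < 1" using r by (simp add: norm_e)
  then obtain c where c: "\<And>k. norm_bound (B ^\<^sub>m k) c"
    using spectral_radius_jnf_norm_bound_less_1_upper_triangular[OF B] by blast
  have "norm_bound (A ^\<^sub>m k) (c * r ^ k)" for k
    unfolding AB smult_pow_mat[OF B] using c[of k] r B
    by (auto simp: norm_bound_def norm_mult norm_power mult.commute[of c])
  then show ?thesis by (rule that)
qed

text \<open>An eigenvalue \<open>e\<close> with \<open>norm e > r\<close> would make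
  \<open>A ^\<^sub>m k *\<^sub>v v = e ^ k *\<^sub>v v\<close> outgrow a bound of order
  \<open>r ^ k\<close> on the entries.\<close>

lemma spectral_radius_leI:
  fixes A :: "complex mat"
  assumes A: "A \<in> carrier_mat n n" and n: "n > 0" and r: "0 < r"
    and bound: "\<And>k. norm_bound (A ^\<^sub>m k) (c * r ^ k)"
  shows "spectral_radius A \<le> r"
proof (rule ccontr)
  assume gt: "\<not> spectral_radius A \<le> r"
  from spectral_radius_mem_max(1)[OF A n] obtain e
    where e: "eigenvalue A e" and norm_e: "spectral_radius A = norm e"
    by (auto simp: spectrum_def)
  then obtain v where ev: "eigenvector A v e" and v: "v \<in> carrier_vec n" "v \<noteq> 0\<^sub>v n"
    using A by (auto simp: eigenvalue_def eigenvector_def)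
  then obtain i where i: "i < n" "vec_index v i \<noteq> 0"
    by (metis carrier_vecD eq_vecI index_zero_vec)
  \<comment> \<open>\<open>S\<close> comes from coordinate \<open>i\<close> of the eigenvector
    equation for \<open>A ^\<^sub>m k\<close>, after bounding the matrix entries and dividing by
    \<open>r ^ k\<close>. It does not depend on \<open>k\<close>.\<close>
  define S where "S = (\<Sum>j<n. norm (vec_index v j)) * c / norm (vec_index v i)"
  have le: "(norm e / r) ^ k \<le> S" for k
  proof -
    have "e ^ k * vec_index v i = vec_index (A ^\<^sub>m k *\<^sub>v v) i"
      using i v eigenvector_pow[OF A ev, of k] by simp
    also have "\<dots> = (\<Sum>j<n. (A ^\<^sub>m k) $$ (i, j) * vec_index v j)"
      using A i v by (auto simp: scalar_prod_def atLeast0LessThan intro!: sum.cong)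
    finally have "norm e ^ k * norm (vec_index v i) = norm \<dots>"
      by (metis norm_mult norm_power)
    also have "\<dots> \<le> (\<Sum>j<n. (c * r ^ k) * norm (vec_index v j))"
    proof (rule sum_norm_le)
      fix j assume "j \<in> {..<n}"
      then have "norm ((A ^\<^sub>m k) $$ (i, j)) \<le> c * r ^ k"
        using bound[of k] A i by (auto simp: norm_bound_def)
      then show "norm ((A ^\<^sub>m k) $$ (i, j) * vec_index v j) \<le> (c * r ^ k) * norm (vec_index v j)"
        by (simp add: norm_mult mult_right_mono)
    qed
    also have "\<dots> = (\<Sum>j<n. norm (vec_index v j)) * c * r ^ k"
      by (simp add: sum_distrib_left sum_distrib_right mult_ac)
    finally show ?thesis
      using r i by (simp add: S_def field_simps)
  qed
  have "1 < norm e / r" using gt r norm_e by simp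
  then obtain k where "S < (norm e / r) ^ k"
    using real_arch_pow by blast
  with le[of k] show False by simp
qed

text \<open>A variant of Gelfand's formula that involves only countably many conditions on the entries of
  powers of the matrix, which makes the spectral norm a measurable function of the entries.\<close>

lemma spectral_norm_le_iff:
  fixes A :: "real mat"
  assumes A: "A \<in> carrier_mat n n" and n: "n > 0" and R: "0 \<le> R"
  shows "spectral_norm A \<le> R \<longleftrightarrow>
    (\<forall>m::nat. \<exists>c::nat. \<forall>k. \<forall>i<n. \<forall>j<n. \<bar>(A ^\<^sub>m k) $$ (i, j)\<bar> \<le> real c * (R + 1 / real (Suc m)) ^ k)"
    (is "_ \<longleftrightarrow> ?rhs")
proof -
  let ?B = "map_mat complex_of_real A"
  let ?r = "\<lambda>m. R + 1 / real (Suc m)"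
  have B: "?B \<in> carrier_mat n n" using A by simp
  have r: "?r m > 0" for m using R by (simp add: add_nonneg_pos)
  have pow: "norm ((?B ^\<^sub>m k) $$ (i, j)) = \<bar>(A ^\<^sub>m k) $$ (i, j)\<bar>" if "i < n" "j < n" for i j k
  proof -
    have "?B ^\<^sub>m k = map_mat complex_of_real (A ^\<^sub>m k)"
      by (rule of_real_hom.mat_hom_pow[OF A, symmetric])
    then show ?thesis using A that by simp
  qed
  have bound_iff: "norm_bound (?B ^\<^sub>m k) b \<longleftrightarrow> (\<forall>i<n. \<forall>j<n. \<bar>(A ^\<^sub>m k) $$ (i, j)\<bar> \<le> b)" for k b
    unfolding norm_bound_def using B pow by auto
  show ?thesis
  proof
    assume le: "spectral_norm A \<le> R"
    show ?rhs
    proof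
      fix m
      have "spectral_radius ?B < ?r m"
        using le by (simp add: spectral_norm_def le_less_trans[of _ R])
      then obtain c where c: "\<And>k. norm_bound (?B ^\<^sub>m k) (c * ?r m ^ k)"
        using norm_bound_pow_mat[OF B n _ r] by blast
      \<comment> \<open>Rounding the constant up to a natural number keeps the quantifier over
        \<open>c\<close> countable.\<close>
      have "norm_bound (?B ^\<^sub>m k) (real (nat \<lceil>c\<rceil>) * ?r m ^ k)" for k
      proof -
        have "c * ?r m ^ k \<le> real (nat \<lceil>c\<rceil>) * ?r m ^ k"
          using r[of m] by (intro mult_right_mono real_nat_ceiling_ge) auto
        then show ?thesis using c[of k] unfolding norm_bound_def by (meson order_trans)
      qed
      then show "\<exists>c::nat. \<forall>k. \<forall>i<n. \<forall>j<n. \<bar>(A ^\<^sub>m k) $$ (i, j)\<bar> \<le> real c * ?r m ^ k"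
        unfolding bound_iff by blast
    qed
  next
    assume ?rhs
    then have "\<exists>c. \<forall>k. norm_bound (?B ^\<^sub>m k) (c * ?r m ^ k)" for m
      unfolding bound_iff by blast
    then have "spectral_radius ?B \<le> ?r m" for m
      using spectral_radius_leI[OF B n r] by blast
    then have "\<forall>m. spectral_norm A \<le> ?r m" by (simp add: spectral_norm_def)
    moreover have "?r \<longlonglongrightarrow> R + 0"
      using LIMSEQ_inverse_real_of_nat by (intro tendsto_intros) (simp add: inverse_eq_divide)
    ultimately show "spectral_norm A \<le> R"
      using LIMSEQ_le_const[of ?r R "spectral_norm A"] by auto
  qed
qed

text \<open>For symmetric \<open>A\<close>, \<open>(A\<^sup>2\<^sup>k)\<^sub>x\<^sub>x = \<Sum>\<^sub>y ((A\<^sup>k)\<^sub>x\<^sub>y)\<^sup>2 \<ge> ((A\<^sup>k)\<^sub>x\<^sub>x)\<^sup>2\<close>, so iterated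
  doubling makes the powers grow at least at the rate \<open>sqrt ((A\<^sup>2)\<^sub>x\<^sub>x)\<close>.\<close>

lemma sum_row_squares_le:
  fixes A :: "real mat"
  assumes A: "A \<in> carrier_mat n n" and n: "n > 0" and R: "0 \<le> R"
    and sym: "\<And>i j. i < n \<Longrightarrow> j < n \<Longrightarrow> A $$ (i, j) = A $$ (j, i)"
    and le: "spectral_norm A \<le> R" and x: "x < n"
  shows "(\<Sum>y<n. (A $$ (x, y))\<^sup>2) \<le> R\<^sup>2"
proof (rule ccontr)
  define s where "s = (\<Sum>y<n. (A $$ (x, y))\<^sup>2)"
  assume "\<not> (\<Sum>y<n. (A $$ (x, y))\<^sup>2) \<le> R\<^sup>2"
  then have "R\<^sup>2 < s" by (simp add: s_def)
  have s0: "0 \<le> s" by (simp add: s_def sum_nonneg)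
  have pow_sym: "(A ^\<^sub>m k) $$ (i, j) = (A ^\<^sub>m k) $$ (j, i)" if "i < n" "j < n" for k i j
    using that
  proof (induction k arbitrary: i j)
    case (Suc k)
    \<comment> \<open>Transposing both factors turns \<open>A ^\<^sub>m k * A\<close> into
      \<open>A * A ^\<^sub>m k\<close>, which is the same power.\<close>
    have "(A ^\<^sub>m Suc k) $$ (i, j) = (\<Sum>l<n. (A ^\<^sub>m k) $$ (i, l) * A $$ (l, j))"
      using A Suc.prems by (simp add: index_mult_mat_sum[of _ n] del: index_mult_mat(1))
    also have "\<dots> = (\<Sum>l<n. A $$ (j, l) * (A ^\<^sub>m k) $$ (l, i))"
      using Suc sym by (intro sum.cong) auto
    also have "\<dots> = (A * A ^\<^sub>m k) $$ (j, i)"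
      using A Suc.prems by (simp add: index_mult_mat_sum[of _ n] del: index_mult_mat(1))
    also have "A * A ^\<^sub>m k = A ^\<^sub>m Suc k"
      using pow_mat_add[OF A, of 1 k] A by (simp del: pow_mat.simps add: pow_mat.simps(1) pow_mat.simps(2)[of A 0])
    finally show ?case .
  qed (use A in auto)
  have diag: "(A ^\<^sub>m (k + k)) $$ (x, x) = (\<Sum>l<n. ((A ^\<^sub>m k) $$ (x, l))\<^sup>2)" for k
    using A x pow_sym by (simp add: pow_mat_add index_mult_mat_sum[of _ n] power2_eq_square del: index_mult_mat(1))
  have grow: "s ^ (2 ^ m) \<le> (A ^\<^sub>m (2 * 2 ^ m)) $$ (x, x)" for m :: nat
  proof (induction m)
    case 0
    show ?case using diag[of 1] A by (simp add: s_def numeral_2_eq_2)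
  next
    case (Suc m)
    have "s ^ (2 ^ Suc m) = (s ^ (2 ^ m))\<^sup>2" by (simp add: power_mult mult.commute flip: power_mult)
    also have "\<dots> \<le> ((A ^\<^sub>m (2 * 2 ^ m)) $$ (x, x))\<^sup>2"
      using Suc s0 by (intro power_mono) auto
    also have "\<dots> \<le> (\<Sum>l<n. ((A ^\<^sub>m (2 * 2 ^ m)) $$ (x, l))\<^sup>2)"
      using x by (intro member_le_sum) auto
    also have "\<dots> = (A ^\<^sub>m (2 * 2 ^ Suc m)) $$ (x, x)"
      by (simp flip: diag add: mult_2)
    finally show ?case .
  qed
  \<comment> \<open>There is room for a rate \<open>r\<close> of the form used in
    \<open>spectral_norm_le_iff\<close> strictly between \<open>R\<close> and \<open>sqrt s\<close>.
    At exponent \<open>2 * 2 ^ j\<close>, growth at least \<open>s ^ (2 ^ j)\<close> then meets a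
    bound of order \<open>r ^ (2 * 2 ^ j)\<close>, although
    \<open>s / r\<^sup>2 > 1\<close>.\<close>
  have "R < sqrt s" using \<open>R\<^sup>2 < s\<close> R by (simp add: real_less_rsqrt)
  then obtain m where m: "1 / real (Suc m) < sqrt s - R"
    using nat_approx_posE[of "sqrt s - R"] by auto
  define r where "r = R + 1 / real (Suc m)"
  have r: "0 < r" "r < sqrt s" using m R by (auto simp: r_def add_nonneg_pos)
  then have q: "1 < s / r\<^sup>2"
    using real_sqrt_less_iff[of "r\<^sup>2" s] by simp
  obtain c :: nat where c: "\<And>k. \<bar>(A ^\<^sub>m k) $$ (x, x)\<bar> \<le> real c * r ^ k"
    using le x unfolding spectral_norm_le_iff[OF A n R] r_def by meson
  have "(s / r\<^sup>2) ^ (2 ^ j) \<le> real c" for j :: nat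
  proof -
    have "s ^ (2 ^ j) \<le> real c * r ^ (2 * 2 ^ j)"
      using grow[of j] c[of "2 * 2 ^ j"] by linarith
    then show ?thesis using r by (simp add: power_divide field_simps flip: power_mult)
  qed
  moreover obtain j where "real c < (s / r\<^sup>2) ^ j"
    using q real_arch_pow by blast
  moreover have "(s / r\<^sup>2) ^ j \<le> (s / r\<^sup>2) ^ (2 ^ j)"
    using q less_exp[of j] by (intro power_increasing) auto
  ultimately show False by (meson not_le order_trans)
qed

section \<open>Measurability of matrix powers and of the spectral norm event\<close>

lemma measurable_pow_mat_entry:
  fixes A :: "'a \<Rightarrow> real mat"
  assumes A: "\<And>\<omega>. A \<omega> \<in> carrier_mat n n"
    and meas: "\<And>i j. i < n \<Longrightarrow> j < n \<Longrightarrow> (\<lambda>\<omega>. A \<omega> $$ (i, j)) \<in> borel_measurable M"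
    and "i < n" "j < n"
  shows "(\<lambda>\<omega>. (A \<omega> ^\<^sub>m k) $$ (i, j)) \<in> borel_measurable M"
  using \<open>j < n\<close>
proof (induction k arbitrary: j)
  case 0
  have "dim_row (A \<omega>) = n" for \<omega> using A by auto
  then show ?case using \<open>i < n\<close> 0 by simp
next
  case (Suc k)
  have "(A \<omega> ^\<^sub>m Suc k) $$ (i, j) = (\<Sum>l<n. (A \<omega> ^\<^sub>m k) $$ (i, l) * A \<omega> $$ (l, j))" for \<omega>
    using A \<open>i < n\<close> Suc.prems by (simp add: index_mult_mat_sum[of _ n] del: index_mult_mat(1))
  then show ?case using Suc meas by simp
qed

lemma measurable_spectral_norm_gt:
  fixes A :: "'a \<Rightarrow> real mat"
  assumes A: "\<And>\<omega>. A \<omega> \<in> carrier_mat n n" and n: "n > 0" and R: "0 \<le> R"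
    and meas: "\<And>i j. i < n \<Longrightarrow> j < n \<Longrightarrow> (\<lambda>\<omega>. A \<omega> $$ (i, j)) \<in> borel_measurable M"
  shows "{\<omega> \<in> space M. spectral_norm (A \<omega>) > R} \<in> sets M"
proof -
  have "Measurable.pred M (\<lambda>\<omega>. \<forall>m::nat. \<exists>c::nat. \<forall>k. \<forall>i<n. \<forall>j<n.
      \<bar>(A \<omega> ^\<^sub>m k) $$ (i, j)\<bar> \<le> real c * (R + 1 / real (Suc m)) ^ k)"
  proof (intro pred_intros_countable pred_intros_imp')
    fix m c k i j :: nat
    assume "i < n" "j < n"
    note [measurable] = measurable_pow_mat_entry[OF A meas this]
    show "Measurable.pred M (\<lambda>\<omega>. \<bar>(A \<omega> ^\<^sub>m k) $$ (i, j)\<bar> \<le> real c * (R + 1 / real (Suc m)) ^ k)"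
      by measurable
  qed
  then have "{\<omega> \<in> space M. \<not> (\<forall>m::nat. \<exists>c::nat. \<forall>k. \<forall>i<n. \<forall>j<n.
      \<bar>(A \<omega> ^\<^sub>m k) $$ (i, j)\<bar> \<le> real c * (R + 1 / real (Suc m)) ^ k)} \<in> sets M"
    by measurable
  then show ?thesis
    by (simp only: spectral_norm_le_iff[OF A n R, symmetric] not_le)
qed

subsection \<open>Independent blocks of events\<close>

context prob_space
begin

text \<open>Functions of disjoint groups of independent variables are independent. This is used
  twice below: to group entries into blocks, and then blocks into rows.\<close>

lemma indep_vars_block_Ball:
  assumes ind: "indep_vars (\<lambda>_. count_space UNIV) X I"
    and K: "\<And>j. j \<in> J \<Longrightarrow> K j \<subseteq> I" "\<And>j. j \<in> J \<Longrightarrow> finite (K j)"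
    and disj: "disjoint_family_on K J"
  shows "indep_vars (\<lambda>_. count_space UNIV) (\<lambda>j \<omega>. \<forall>i\<in>K j. X i \<omega>) J"
proof -
  have "indep_vars (\<lambda>_. count_space UNIV)
      (\<lambda>j \<omega>. \<forall>i\<in>K j. (restrict (\<lambda>i. X i \<omega>) (K j)) i) J"
  proof (rule indep_vars_compose2[OF indep_vars_restrict[OF ind K(1) disj]])
    fix j assume "j \<in> J"
    then have [simp]: "finite (K j)" by (rule K)
    show "(\<lambda>f. \<forall>i\<in>K j. f i) \<in> (\<Pi>\<^sub>M i\<in>K j. count_space UNIV) \<rightarrow>\<^sub>M count_space UNIV"
      by (intro pred_intros_finite) (auto intro: measurable_component_singleton)
  qed
  then show ?thesis by (simp cong: ball_cong)
qed

lemma prob_Ball_indep_vars: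
  assumes ind: "indep_vars (\<lambda>_. count_space UNIV) X I" and fin: "finite I"
  shows "\<P>(\<omega> in M. \<forall>i\<in>I. X i \<omega>) = (\<Prod>i\<in>I. \<P>(\<omega> in M. X i \<omega>))"
proof (cases "I = {}")
  case False
  have "{\<omega> \<in> space M. \<forall>i\<in>I. X i \<omega>} = (\<Inter>i\<in>I. X i -` {True} \<inter> space M)"
    using False by auto
  moreover have "{\<omega> \<in> space M. X i \<omega>} = X i -` {True} \<inter> space M" for i by auto
  ultimately show ?thesis
    using indep_varsD_finite[OF ind False fin, of "\<lambda>_. {True}"] by simp
qed (simp add: prob_space)

lemma indep_vars_not:
  assumes "indep_vars (\<lambda>_. count_space UNIV) X I"
  shows "indep_vars (\<lambda>_. count_space UNIV) (\<lambda>i \<omega>. \<not> X i \<omega>) I"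
  by (rule indep_vars_compose2[OF assms]) simp

text \<open>In the application \<open>X i\<close> says that edge \<open>i\<close> is absent, and
  \<open>q\<close> is the edge probability. A block of \<open>L\<close> entries contains an edge
  with probability \<open>1 - (1 - q) ^ L\<close>; independence over the blocks of a row gives the
  power \<open>card T\<close>, and independence over the rows gives the power \<open>card S\<close>
  of the failure probability.\<close>

lemma prob_no_row_meets_all_blocks:
  fixes q :: real
  assumes ind: "indep_vars (\<lambda>_. count_space UNIV) X I"
    and q: "\<And>i. i \<in> I \<Longrightarrow> \<P>(\<omega> in M. X i \<omega>) = 1 - q"
    and B: "\<And>x j. x \<in> S \<Longrightarrow> j \<in> T \<Longrightarrow> B x j \<subseteq> I \<and> finite (B x j) \<and> card (B x j) = L"
    and disj: "disjoint_family_on (\<lambda>(x, j). B x j) (S \<times> T)"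
    and fin: "finite S" "finite T"
  shows "\<P>(\<omega> in M. \<forall>x\<in>S. \<exists>j\<in>T. \<forall>i\<in>B x j. X i \<omega>) = (1 - (1 - (1 - q) ^ L) ^ card T) ^ card S"
proof -
  \<comment> \<open>\<open>?Y\<close> says that a block contains no edge, \<open>?Z\<close> that row
    \<open>x\<close> has an edge in every block.\<close>
  let ?Y = "\<lambda>(x, j) \<omega>. \<forall>i\<in>B x j. X i \<omega>"
  let ?Z = "\<lambda>x \<omega>. \<forall>xj\<in>{x} \<times> T. \<not> ?Y xj \<omega>"
  have "indep_vars (\<lambda>_. count_space UNIV) (\<lambda>xj \<omega>. \<forall>i\<in>(\<lambda>(x, j). B x j) xj. X i \<omega>) (S \<times> T)"
    using B disj by (intro indep_vars_block_Ball[OF ind]) (fastforce, auto)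
  then have Y: "indep_vars (\<lambda>_. count_space UNIV) ?Y (S \<times> T)"
    by (simp add: case_prod_unfold)
  have probY: "\<P>(\<omega> in M. ?Y xj \<omega>) = (1 - q) ^ L" if "xj \<in> S \<times> T" for xj
  proof -
    have B': "B (fst xj) (snd xj) \<subseteq> I" "finite (B (fst xj) (snd xj))" "card (B (fst xj) (snd xj)) = L"
      using that B[of "fst xj" "snd xj"] by auto
    have "\<P>(\<omega> in M. ?Y xj \<omega>) = (\<Prod>i\<in>B (fst xj) (snd xj). \<P>(\<omega> in M. X i \<omega>))"
      using prob_Ball_indep_vars[OF indep_vars_subset[OF ind B'(1)] B'(2)]
      by (simp add: case_prod_unfold)
    also have "\<dots> = (\<Prod>i\<in>B (fst xj) (snd xj). 1 - q)"
      using q B'(1) by (intro prod.cong) auto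
    finally show ?thesis using B' by simp
  qed
  have notY: "indep_vars (\<lambda>_. count_space UNIV) (\<lambda>xj \<omega>. \<not> ?Y xj \<omega>) (S \<times> T)"
    by (rule indep_vars_not[OF Y])
  have prob_notY: "\<P>(\<omega> in M. \<not> ?Y xj \<omega>) = 1 - (1 - q) ^ L" if "xj \<in> S \<times> T" for xj
  proof -
    have "?Y xj \<in> M \<rightarrow>\<^sub>M count_space UNIV"
      using Y that unfolding indep_vars_def by blast
    then have "{\<omega> \<in> space M. ?Y xj \<omega>} \<in> events" by measurable
    then show ?thesis using prob_neg[of "?Y xj"] probY[OF that] by simp
  qed
  have Z: "indep_vars (\<lambda>_. count_space UNIV) ?Z S"
    by (rule indep_vars_block_Ball[OF notY]) (use fin in \<open>auto simp: disjoint_family_on_def\<close>)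
  have probZ: "\<P>(\<omega> in M. ?Z x \<omega>) = (1 - (1 - q) ^ L) ^ card T" if "x \<in> S" for x
  proof -
    have sub: "{x} \<times> T \<subseteq> S \<times> T" using that by auto
    have "\<P>(\<omega> in M. ?Z x \<omega>) = (\<Prod>xj\<in>{x} \<times> T. \<P>(\<omega> in M. \<not> ?Y xj \<omega>))"
      using fin by (intro prob_Ball_indep_vars[OF indep_vars_subset[OF notY sub]]) auto
    also have "\<dots> = (\<Prod>xj\<in>{x} \<times> T. 1 - (1 - q) ^ L)"
      using sub prob_notY by (intro prod.cong) auto
    finally show ?thesis by (simp add: card_cartesian_product)
  qed
  have prob_notZ: "\<P>(\<omega> in M. \<not> ?Z x \<omega>) = 1 - (1 - (1 - q) ^ L) ^ card T" if "x \<in> S" for x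
  proof -
    have "?Z x \<in> M \<rightarrow>\<^sub>M count_space UNIV"
      using Z that unfolding indep_vars_def by blast
    then have "{\<omega> \<in> space M. ?Z x \<omega>} \<in> events" by measurable
    then show ?thesis using prob_neg[of "?Z x"] probZ[OF that] by simp
  qed
  have "\<P>(\<omega> in M. \<forall>x\<in>S. \<not> ?Z x \<omega>) = (\<Prod>x\<in>S. 1 - (1 - (1 - q) ^ L) ^ card T)"
    using prob_Ball_indep_vars[OF indep_vars_not[OF Z] fin(1)] prob_notZ by simp
  then show ?thesis by simp
qed

end

section \<open>Asymptotics of the failure probability\<close>

lemma no_row_probability_tendsto_0:
  fixes p :: "nat \<Rightarrow> real" and R :: real
  defines "k \<equiv> \<lambda>N. Suc (nat \<lceil>R\<^sup>2 * p N\<rceil>)"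
  assumes p: "\<And>N. 1 \<le> N \<Longrightarrow> 0 < p N \<and> p N \<le> real N"
    and lim: "filterlim p at_top sequentially"
    and small: "(\<lambda>N. p N / ln (real N)) \<longlonglongrightarrow> 0"
  shows "(\<lambda>N. (1 - (1 - (1 - p N / real N) ^ ((N - N div 2) div k N)) ^ k N) ^ (N div 2)) \<longlonglongrightarrow> 0"
proof -
  \<comment> \<open>\<open>K\<close> absorbs the rounding in \<open>k\<close>: once
    \<open>p N >= 1\<close>, \<open>k N <= K * p N\<close>. The constant \<open>c\<close> bounds
    from below the chance that a block is hit, and \<open>g\<close> is its decay rate, so that
    \<open>c ^ k N = exp (- g * k N)\<close>.\<close>
  define K where "K = R\<^sup>2 + 2"
  define c where "c = 1 - exp (- (1 / (4 * K)))"
  define g where "g = - ln c"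
  have K: "K \<ge> 2" by (simp add: K_def)
  have c: "0 < c" "c < 1" using K by (auto simp: c_def)
  have g: "0 < g" "c = exp (- g)" using c by (auto simp: g_def)
  have ev1: "eventually (\<lambda>N. 1 \<le> p N) sequentially"
    using lim by (auto simp: filterlim_at_top)
  \<comment> \<open>The threshold is chosen so that \<open>K * p N\<close> and
    \<open>g * K * p N\<close> together stay below \<open>ln N / 4\<close>: the first keeps the
    blocks long, the second gives \<open>c ^ k N >= N powr (-1/4)\<close>.\<close>
  have ev2: "eventually (\<lambda>N. p N / ln (real N) < 1 / (4 * K * (g + 1))) sequentially"
    using g K by (intro order_tendstoD(2)[OF small]) simp
  have ev3: "eventually (\<lambda>N. 4 * ln (real N) \<le> real N) sequentially"
    by real_asymp
  have bound: "eventually (\<lambda>N. \<bar>(1 - (1 - (1 - p N / real N) ^ ((N - N div 2) div k N)) ^ k N) ^ (N div 2)\<bar>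
      \<le> exp (- (real N powr (3 / 4) / 3))) sequentially"
    using ev1 ev2 ev3 eventually_ge_at_top[of 3]
  proof eventually_elim
    case (elim N)
    define m where "m = N - N div 2"
    define L where "L = m div k N"
    define q where "q = p N / real N"
    have lnN: "0 < ln (real N)" using elim by simp
    have q: "0 < q" "q \<le> 1" using p[of N] elim by (auto simp: q_def)
    have "p N < ln (real N) * (1 / (4 * K * (g + 1)))"
      using elim lnN by (simp add: field_simps)
    then have "4 * (K * (g + 1)) * p N < ln (real N)"
      using K g by (simp add: pos_less_divide_eq mult_ac)
    then have Kgp: "4 * (K * g * p N) + 4 * (K * p N) < ln (real N)"
      by (simp add: algebra_simps)
    have pos: "0 \<le> K * g * p N" using K g p[of N] elim by simp
    have kle: "real (k N) \<le> K * p N"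
    proof -
      have "real (k N) = 1 + of_int \<lceil>R\<^sup>2 * p N\<rceil>"
        using elim by (simp add: k_def)
      also have "\<dots> \<le> R\<^sup>2 * p N + 2" by linarith
      finally show ?thesis using elim by (simp add: K_def algebra_simps)
    qed
    have kpos: "0 < k N" by (simp add: k_def)
    have "real N / 2 \<le> real m" unfolding m_def by linarith
    moreover have "4 * (K * p N) \<le> ln (real N)" using Kgp pos by linarith
    ultimately have mk: "real (2 * k N) \<le> real m"
      using kle elim by linarith
    \<comment> \<open>Since \<open>m >= 2 * k N\<close>, rounding \<open>m / k N\<close> down costs
      less than half: \<open>L * k N > m - k N >= m / 2 >= N / 4\<close>. With
      \<open>k N <= K * p N\<close> this gives \<open>q * L >= 1 / (4 * K)\<close>, the exponent in
      \<open>c\<close>.\<close>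
    have "m < (L + 1) * k N"
      unfolding L_def using kpos by (metis Suc_eq_plus1 dividend_less_times_div mult.commute mult_Suc_right)
    then have "real m < (real L + 1) * real (k N)"
      by (metis of_nat_1 of_nat_add of_nat_less_iff of_nat_mult)
    then have "real m / 2 < real L * real (k N)"
      using mk by (simp add: algebra_simps)
    then have "real N / 4 < real L * real (k N)"
      using \<open>real N / 2 \<le> real m\<close> by linarith
    also have "\<dots> \<le> real L * (K * p N)" using kle by (intro mult_left_mono) auto
    finally have "1 / (4 * K) \<le> q * real L"
      using elim K by (simp add: q_def field_simps)
    have "(1 - q) ^ L \<le> exp (- q) ^ L"
      using q exp_ge_add_one_self[of "- q"] by (intro power_mono) auto
    also have "\<dots> = exp (- (q * real L))" by (simp flip: exp_of_nat_mult add: mult.commute)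
    also have "\<dots> \<le> exp (- (1 / (4 * K)))" using \<open>1 / (4 * K) \<le> q * real L\<close> by simp
    finally have hit: "c \<le> 1 - (1 - q) ^ L" by (simp add: c_def)
    have hit1: "1 - (1 - q) ^ L \<le> 1" using q by simp
    define t where "t = (1 - (1 - q) ^ L) ^ k N"
    have t1: "t \<le> 1" using hit hit1 c by (auto simp: t_def intro!: power_le_one)
    have "exp (- (ln (real N) / 4)) \<le> exp (- (g * real (k N)))"
    proof -
      have "g * real (k N) \<le> g * (K * p N)" using kle g by (intro mult_left_mono) auto
      moreover have "0 \<le> K * p N" using K elim by simp
      ultimately show ?thesis using Kgp by (simp add: mult_ac)
    qed
    also have "\<dots> = c ^ k N" using g by (simp flip: exp_of_nat_mult add: mult.commute)
    also have "\<dots> \<le> t" unfolding t_def using hit c by (intro power_mono) auto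
    finally have t: "real N powr (- 1 / 4) \<le> t" using elim by (simp add: powr_def)
    \<comment> \<open>A row succeeds with probability \<open>t >= N powr (-1/4)\<close>, so the
      expected number of successful rows is at least of order \<open>N powr (3/4)\<close>; by
      \<open>1 - t <= exp (- t)\<close> the failure probability is exponentially small in
      it.\<close>
    have "(1 - t) ^ (N div 2) \<le> exp (- t) ^ (N div 2)"
      using t1 exp_ge_add_one_self[of "- t"] by (intro power_mono) auto
    also have "\<dots> = exp (- (real (N div 2) * t))" by (simp flip: exp_of_nat_mult)
    also have "\<dots> \<le> exp (- (real N / 3 * real N powr (- 1 / 4)))"
    proof -
      have "N \<le> 3 * (N div 2)" using elim by linarith
      then have "real N / 3 \<le> real (N div 2)" by linarith
      then have "real N / 3 * real N powr (- 1 / 4) \<le> real (N div 2) * t"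
        using t by (intro mult_mono) auto
      then show ?thesis by simp
    qed
    also have "real N / 3 * real N powr (- 1 / 4) = real N powr (3 / 4) / 3"
      using elim powr_add[of "real N" 1 "- 1 / 4"] by simp
    finally have "(1 - t) ^ (N div 2) \<le> exp (- (real N powr (3 / 4) / 3))" .
    moreover have "0 \<le> (1 - t) ^ (N div 2)" using t1 by simp
    ultimately show ?case by (simp add: t_def q_def L_def m_def)
  qed
  have lim0: "(\<lambda>N. exp (- (real N powr (3 / 4) / 3))) \<longlonglongrightarrow> 0"
    by real_asymp
  show ?thesis
    using bound by (intro Lim_null_comparison[OF _ lim0]) simp
qed

subsection \<open>Norm of the dilute matrix\<close>

text \<open>Each \<open>y\<close> in \<open>Y\<close> contributes \<open>1 / p\<close> to the sum of
  squares of row \<open>x\<close>, which therefore exceeds \<open>R\<^sup>2\<close>, contrary to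
  \<open>sum_row_squares_le\<close> if the norm were at most \<open>R\<close>.\<close>

lemma spectral_norm_dilute_matrix_gt:
  fixes a d :: "nat \<Rightarrow> nat \<Rightarrow> real"
  assumes R: "0 \<le> R" and p: "0 < p"
    and sym: "\<And>x y. 1 \<le> x \<Longrightarrow> x \<le> y \<Longrightarrow> y \<le> N \<Longrightarrow> a y x = a x y \<and> d y x = d x y"
    and x: "x \<in> {1..N}" and Y: "Y \<subseteq> {1..N}"
    and one: "\<And>y. y \<in> Y \<Longrightarrow> (a x y)\<^sup>2 = 1 \<and> d x y = 1"
    and card: "R\<^sup>2 * p < real (card Y)"
  shows "R < spectral_norm (dilute_matrix N p a d)"
proof (rule ccontr)
  let ?A = "dilute_matrix N p a d"
  assume "\<not> R < spectral_norm ?A"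
  then have le: "spectral_norm ?A \<le> R" by simp
  have A: "?A \<in> carrier_mat N N" by (simp add: dilute_matrix_def)
  have "?A $$ (i, j) = ?A $$ (j, i)" if "i < N" "j < N" for i j
    using that sym[of "i + 1" "j + 1"] sym[of "j + 1" "i + 1"]
    by (cases "i \<le> j") (auto simp: dilute_matrix_def)
  then have "(\<Sum>y<N. (?A $$ (x - 1, y))\<^sup>2) \<le> R\<^sup>2"
    using x by (intro sum_row_squares_le[OF A _ R _ le]) auto
  also have "R\<^sup>2 < real (card Y) / p" using card p by (simp add: field_simps)
  also have "\<dots> = (\<Sum>y\<in>Y. (?A $$ (x - 1, y - 1))\<^sup>2)"
  proof -
    have "(?A $$ (x - 1, y - 1))\<^sup>2 = 1 / p" if "y \<in> Y" for y
    proof -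
      have "1 \<le> y" "y \<le> N" using that Y by auto
      then have "?A $$ (x - 1, y - 1) = 1 / sqrt p * a x y * d x y"
        using x by (auto simp: dilute_matrix_def)
      then show ?thesis using one[OF that] p by (simp add: power_mult_distrib power_divide)
    qed
    then show ?thesis by simp
  qed
  \<comment> \<open>The shift from vertices to matrix indices is injective because \<open>0\<close>
    is not in \<open>Y\<close>; truncated subtraction would otherwise identify \<open>0\<close> and
    \<open>1\<close>.\<close>
  also have "\<dots> = (\<Sum>y\<in>(\<lambda>y. y - 1) ` Y. (?A $$ (x - 1, y))\<^sup>2)"
  proof -
    have "inj_on (\<lambda>y. y - 1) Y" using Y by (intro inj_on_diff_nat) auto
    then show ?thesis by (simp add: sum.reindex)
  qed
  also have "\<dots> \<le> (\<Sum>y<N. (?A $$ (x - 1, y))\<^sup>2)"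
    using Y by (intro sum_mono2) force+
  finally show False by simp
qed

section \<open>Lower bound for the probability of a large norm, and its limit\<close>

theorem theorem2p2:
  fixes Ma :: "'a measure"
    and Md :: "nat \<Rightarrow> 'd measure"
    and a :: "nat \<Rightarrow> nat \<Rightarrow> 'a \<Rightarrow> real"
    and d :: "nat \<Rightarrow> nat \<Rightarrow> nat \<Rightarrow> 'd \<Rightarrow> real"
    and p :: "nat \<Rightarrow> real"
    and \<delta> R :: real
  assumes "prob_space Ma"
    and "prob_space.indep_vars Ma (\<lambda>_. borel) (\<lambda>(x, y). a x y) {(x, y). 1 \<le> x \<and> x \<le> y}"
    and "\<And>x y. 1 \<le> x \<Longrightarrow> x \<le> y \<Longrightarrow> \<P>(\<omega> in Ma. a x y \<omega> = 1) = 1 / 2"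
    and "\<And>x y. 1 \<le> x \<Longrightarrow> x \<le> y \<Longrightarrow> \<P>(\<omega> in Ma. a x y \<omega> = - 1) = 1 / 2"
    and "\<And>x y \<omega>. 1 \<le> x \<Longrightarrow> x \<le> y \<Longrightarrow> \<omega> \<in> space Ma \<Longrightarrow> a y x \<omega> = a x y \<omega>"
    and "\<And>N. 1 \<le> N \<Longrightarrow> 0 < p N \<and> p N \<le> real N"
    and "\<And>N. 1 \<le> N \<Longrightarrow> prob_space (Md N)"
    and "\<And>N. 1 \<le> N \<Longrightarrow> prob_space.indep_vars (Md N) (\<lambda>_. borel) (\<lambda>(x, y). d N x y)
                        {(x, y). 1 \<le> x \<and> x \<le> y \<and> y \<le> N}"
    and "\<And>N x y. 1 \<le> x \<Longrightarrow> x \<le> y \<Longrightarrow> y \<le> N \<Longrightarrow>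
           \<P>(\<omega> in Md N. d N x y \<omega> = 1) = p N / real N"
    and "\<And>N x y. 1 \<le> x \<Longrightarrow> x \<le> y \<Longrightarrow> y \<le> N \<Longrightarrow>
           \<P>(\<omega> in Md N. d N x y \<omega> = 0) = 1 - p N / real N"
    and "\<And>N x y \<omega>. 1 \<le> x \<Longrightarrow> x \<le> y \<Longrightarrow> y \<le> N \<Longrightarrow> \<omega> \<in> space (Md N) \<Longrightarrow>
           d N y x \<omega> = d N x y \<omega>"
    and "0 < \<delta>" and "\<delta> < 1"
    and "filterlim p at_top sequentially"
    and "(\<lambda>N. p N / ln (real N) powr (1 - \<delta>)) \<longlonglongrightarrow> 0"
    and "R > 0"
  shows "(\<lambda>N. \<P>(\<omega> in Ma \<Otimes>\<^sub>M Md N.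
            spectral_norm (dilute_matrix N (p N)
              (\<lambda>x y. a x y (fst \<omega>)) (\<lambda>x y. d N x y (snd \<omega>))) > R)) \<longlonglongrightarrow> 1"
proof -
  interpret A: prob_space Ma by fact
  note a_ind = assms(2) and a_pos = assms(3) and a_neg = assms(4) and a_sym = assms(5)
    and p = assms(6) and d_prob = assms(7) and d_ind = assms(8) and d_one = assms(9)
    and d_sym = assms(11) and p_lim = assms(14) and p_small = assms(15)
  define n where "n N = N div 2" for N :: nat
  \<comment> \<open>The successor makes \<open>k N\<close> exceed \<open>R\<^sup>2 * p N\<close>
    strictly and keeps the divisor in \<open>L\<close> nonzero.\<close>
  define k where "k N = Suc (nat \<lceil>R\<^sup>2 * p N\<rceil>)" for N
  have k_gt: "R\<^sup>2 * p N < real (k N)" for N unfolding k_def by linarith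
  define L where "L N = (N - n N) div k N" for N
  define err where "err N = (1 - (1 - (1 - p N / real N) ^ L N) ^ k N) ^ n N" for N
  define G where "G N = {\<omega> \<in> space (Ma \<Otimes>\<^sub>M Md N). spectral_norm (dilute_matrix N (p N)
              (\<lambda>x y. a x y (fst \<omega>)) (\<lambda>x y. d N x y (snd \<omega>))) > R}" for N
  \<comment> \<open>Blocks start just after \<open>n N\<close>, so an edge from a row
    \<open>x <= n N\<close> into a block always has \<open>x < y\<close> and no edge is counted for
    two rows.\<close>
  define block where "block N j = {n N + 1 + j * L N ..< n N + 1 + Suc j * L N}" for N j
  have block_less: "y < z" if "i < j" "y \<in> block N i" "z \<in> block N j" for i j y z N
  proof -
    have "Suc i * L N \<le> j * L N" using \<open>i < j\<close> by (intro mult_le_mono1) simp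
    then show ?thesis using that unfolding block_def by auto
  qed
  have block_sub: "block N j \<subseteq> {n N <.. N}" if "j < k N" for N j
  proof -
    have "Suc j * L N \<le> k N * L N" using that by (intro mult_le_mono1) simp
    also have "\<dots> \<le> N - n N" by (simp add: L_def)
    finally show ?thesis by (auto simp: block_def n_def)
  qed
  have a_meas: "(\<lambda>\<omega>. a x y \<omega>) \<in> borel_measurable Ma" if "1 \<le> x" "x \<le> y" for x y
    using a_ind that unfolding A.indep_vars_def by auto
  have a_meas': "(\<lambda>\<omega>. a x y \<omega>) \<in> borel_measurable Ma" if "1 \<le> x" "1 \<le> y" for x y
  proof (cases "x \<le> y")
    case False
    then show ?thesis
      using a_sym[of y x] a_meas[of y x] that by (subst measurable_cong[where g = "a y x"]) auto
  qed (use a_meas that in auto)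
  \<comment> \<open>The values 1 and -1 already carry total mass 1.\<close>
  have a_square: "AE \<omega> in Ma. (a x y \<omega>)\<^sup>2 = 1" if xy: "1 \<le> x" "x \<le> y" for x y
  proof -
    note [measurable] = a_meas[OF xy]
    have "A.prob ({\<omega> \<in> space Ma. a x y \<omega> = 1} \<union> {\<omega> \<in> space Ma. a x y \<omega> = - 1}) = 1 / 2 + 1 / 2"
      by (subst A.finite_measure_Union) (use a_pos[OF xy] a_neg[OF xy] in auto)
    then have "AE \<omega> in Ma. \<omega> \<in> {\<omega> \<in> space Ma. a x y \<omega> = 1} \<union> {\<omega> \<in> space Ma. a x y \<omega> = - 1}"
      by (subst A.AE_in_set_eq_1) auto
    then show ?thesis by (auto elim!: AE_mp)
  qed
  have lower: "1 - err N \<le> measure (Ma \<Otimes>\<^sub>M Md N) (G N) \<and> measure (Ma \<Otimes>\<^sub>M Md N) (G N) \<le> 1"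
    if N: "1 \<le> N" for N
  proof -
    interpret D: prob_space "Md N" by (rule d_prob[OF N])
    interpret P: pair_prob_space Ma "Md N" ..
    let ?I = "{(x, y). 1 \<le> x \<and> x \<le> y \<and> y \<le> N}"
    have d_meas: "(\<lambda>\<omega>. d N x y \<omega>) \<in> borel_measurable (Md N)" if "1 \<le> x" "x \<le> y" "y \<le> N" for x y
      using d_ind[OF N] that unfolding D.indep_vars_def by auto
    have d_meas': "(\<lambda>\<omega>. d N x y \<omega>) \<in> borel_measurable (Md N)"
      if "1 \<le> x" "1 \<le> y" "x \<le> N" "y \<le> N" for x y
    proof (cases "x \<le> y")
      case False
      then show ?thesis
        using d_sym[of y x N] d_meas[of y x] that by (subst measurable_cong[where g = "d N y x"]) auto
    qed (use d_meas that in auto)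
    \<comment> \<open>Monotonicity of the measure needs this: a nonmeasurable set has measure 0 by
      default.\<close>
    have G_sets: "G N \<in> sets (Ma \<Otimes>\<^sub>M Md N)"
      unfolding G_def
    proof (rule measurable_spectral_norm_gt[where n = N])
      fix i j assume "i < N" "j < N"
      then have [measurable]: "a (Suc i) (Suc j) \<in> borel_measurable Ma"
        "d N (Suc i) (Suc j) \<in> borel_measurable (Md N)"
        using a_meas' d_meas' by auto
      show "(\<lambda>\<omega>. dilute_matrix N (p N) (\<lambda>x y. a x y (fst \<omega>)) (\<lambda>x y. d N x y (snd \<omega>)) $$ (i, j))
          \<in> borel_measurable (Ma \<Otimes>\<^sub>M Md N)"
        using \<open>i < N\<close> \<open>j < N\<close> by (simp add: dilute_matrix_def)
    qed (use N \<open>R > 0\<close> in \<open>auto simp: dilute_matrix_def\<close>)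
    \<comment> \<open>\<open>F\<close> is an almost sure condition on the signs and \<open>E\<close>
      a condition on the graph alone, so \<open>F \<times> E\<close> is a rectangle inside
      \<open>G N\<close> whose product measure factorizes.\<close>
    define F where "F = {\<omega> \<in> space Ma. \<forall>x\<in>{1..N}. \<forall>y\<in>{x..N}. (a x y \<omega>)\<^sup>2 = 1}"
    define E where "E = {\<omega> \<in> space (Md N). \<exists>x\<in>{1..n N}. \<forall>j\<in>{..<k N}. \<exists>y\<in>block N j. d N x y \<omega> = 1}"
    have F_sets: "F \<in> sets Ma"
    proof -
      have "Measurable.pred Ma (\<lambda>\<omega>. \<forall>x\<in>{1..N}. \<forall>y\<in>{x..N}. (a x y \<omega>)\<^sup>2 = 1)"
      proof (intro pred_intros_finite)
        fix x y assume "x \<in> {1..N}" "y \<in> {x..N}"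
        then have [measurable]: "a x y \<in> borel_measurable Ma" using a_meas by auto
        show "Measurable.pred Ma (\<lambda>\<omega>. (a x y \<omega>)\<^sup>2 = 1)" by measurable
      qed auto
      then show ?thesis unfolding F_def by measurable
    qed
    have F_prob: "A.prob F = 1"
    proof -
      have "AE \<omega> in Ma. \<forall>x\<in>{1..N}. \<forall>y\<in>{x..N}. (a x y \<omega>)\<^sup>2 = 1"
        by (intro AE_finite_allI a_square) auto
      then have "AE \<omega> in Ma. \<omega> \<in> F" by (auto simp: F_def elim!: AE_mp)
      then show ?thesis using A.prob_eq_1[OF F_sets] by simp
    qed
    have E_sets: "E \<in> sets (Md N)"
    proof -
      have "Measurable.pred (Md N) (\<lambda>\<omega>. \<exists>x\<in>{1..n N}. \<forall>j\<in>{..<k N}. \<exists>y\<in>block N j. d N x y \<omega> = 1)"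
      proof (intro pred_intros_finite)
        fix x j y assume "x \<in> {1..n N}" "j \<in> {..<k N}" "y \<in> block N j"
        then have [measurable]: "d N x y \<in> borel_measurable (Md N)"
          using d_meas[of x y] block_sub[of j N] by auto
        show "Measurable.pred (Md N) (\<lambda>\<omega>. d N x y \<omega> = 1)" by measurable
      qed (auto simp: block_def)
      then show ?thesis unfolding E_def by measurable
    qed
    have E_prob: "D.prob E = 1 - err N"
    proof -
      have "D.prob {\<omega> \<in> space (Md N). \<forall>x\<in>{1..n N}. \<exists>j\<in>{..<k N}. \<forall>i\<in>{x} \<times> block N j.
            d N (fst i) (snd i) \<omega> \<noteq> 1}
          = (1 - (1 - (1 - p N / real N) ^ L N) ^ card {..<k N}) ^ card {1..n N}"
      proof (rule D.prob_no_row_meets_all_blocks[where I = ?I])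
        show "D.indep_vars (\<lambda>_. count_space UNIV) (\<lambda>i \<omega>. d N (fst i) (snd i) \<omega> \<noteq> 1) ?I"
          using D.indep_vars_compose2[OF d_ind[OF N], of "\<lambda>_ r. r \<noteq> 1" "\<lambda>_. count_space UNIV"]
          by (simp add: case_prod_unfold)
        show "D.prob {\<omega> \<in> space (Md N). d N (fst i) (snd i) \<omega> \<noteq> 1} = 1 - p N / real N"
          if "i \<in> ?I" for i
        proof -
          have i: "1 \<le> fst i" "fst i \<le> snd i" "snd i \<le> N" using that by auto
          note [measurable] = d_meas[OF i]
          show ?thesis
            using D.prob_neg[of "\<lambda>\<omega>. d N (fst i) (snd i) \<omega> = 1"] d_one[OF i] by simp
        qed
        show "{x} \<times> block N j \<subseteq> ?I \<and> finite ({x} \<times> block N j) \<and> card ({x} \<times> block N j) = L N"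
          if "x \<in> {1..n N}" "j \<in> {..<k N}" for x j
          using that block_sub[of j N] by (auto simp: card_cartesian_product block_def)
        show "disjoint_family_on (\<lambda>(x, j). {x} \<times> block N j) ({1..n N} \<times> {..<k N})"
        proof -
          have "block N i \<inter> block N j = {}" if "i \<noteq> j" for i j
            using that block_less by (meson disjoint_iff less_irrefl linorder_neqE_nat)
          then show ?thesis by (auto simp: disjoint_family_on_def Times_Int_Times)
        qed
      qed auto
      then have "D.prob {\<omega> \<in> space (Md N). \<not> (\<exists>x\<in>{1..n N}. \<forall>j\<in>{..<k N}. \<exists>y\<in>block N j. d N x y \<omega> = 1)} = err N"
        by (simp add: err_def)
      then show ?thesis using D.prob_neg E_sets unfolding E_def by force
    qed
    have "F \<times> E \<subseteq> G N"
    proof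
      fix \<omega> assume "\<omega> \<in> F \<times> E"
      then have \<omega>: "fst \<omega> \<in> F" "snd \<omega> \<in> E" by auto
      then have sp: "fst \<omega> \<in> space Ma" "snd \<omega> \<in> space (Md N)" by (auto simp: F_def E_def)
      obtain x where x: "x \<in> {1..n N}" and "\<forall>j\<in>{..<k N}. \<exists>y\<in>block N j. d N x y (snd \<omega>) = 1"
        using \<omega> by (auto simp: E_def)
      then obtain y where y: "\<And>j. j < k N \<Longrightarrow> y j \<in> block N j \<and> d N x (y j) (snd \<omega>) = 1"
        by (metis lessThan_iff)
      \<comment> \<open>The blocks lie in increasing order, so the neighbours picked from them are
        distinct and \<open>x\<close> has at least \<open>k N\<close> of them.\<close>
      have "inj_on y {..<k N}"
      proof (rule linorder_inj_onI)
        fix i j assume "i < j" "i \<in> {..<k N}" "j \<in> {..<k N}"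
        then have "y i < y j" using y block_less[of i j "y i" N "y j"] by simp
        then show "y i \<noteq> y j" by simp
      qed auto
      then have card: "card (y ` {..<k N}) = k N" by (simp add: card_image)
      have yN: "x \<le> y j \<and> y j \<le> N" if "j < k N" for j
        using y[OF that] block_sub[OF that] x by auto
      have "R < spectral_norm (dilute_matrix N (p N) (\<lambda>x y. a x y (fst \<omega>)) (\<lambda>x y. d N x y (snd \<omega>)))"
      proof (rule spectral_norm_dilute_matrix_gt[where x = x and Y = "y ` {..<k N}"])
        show "R\<^sup>2 * p N < real (card (y ` {..<k N}))"
          using k_gt by (simp add: card)
        show "a z x (fst \<omega>) = a x z (fst \<omega>) \<and> d N z x (snd \<omega>) = d N x z (snd \<omega>)"
          if "1 \<le> x" "x \<le> z" "z \<le> N" for x z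
          using that sp a_sym d_sym by blast
        show "(a x z (fst \<omega>))\<^sup>2 = 1 \<and> d N x z (snd \<omega>) = 1" if "z \<in> y ` {..<k N}" for z
          using that y yN x \<omega> by (auto simp: F_def n_def)
        show "x \<in> {1..N}" using x by (auto simp: n_def)
        show "y ` {..<k N} \<subseteq> {1..N}" using yN x by fastforce
      qed (use \<open>R > 0\<close> p[OF N] in auto)
      then show "\<omega> \<in> G N" using sp by (simp add: G_def space_pair_measure mem_Times_iff)
    qed
    then have "measure (Ma \<Otimes>\<^sub>M Md N) (F \<times> E) \<le> measure (Ma \<Otimes>\<^sub>M Md N) (G N)"
      by (intro P.finite_measure_mono G_sets)
    moreover have "measure (Ma \<Otimes>\<^sub>M Md N) (F \<times> E) = A.prob F * D.prob E"
      using D.emeasure_pair_measure_Times[OF F_sets E_sets] by (simp add: measure_def enn2real_mult)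
    ultimately show ?thesis by (simp add: F_prob E_prob)
  qed
  \<comment> \<open>For \<open>N >= 3\<close> we have \<open>ln N >= 1\<close>, because
    \<open>exp 1 <= 3\<close>; a power of \<open>ln N\<close> with exponent
    \<open>1 - \<delta> < 1\<close> is then at most \<open>ln N\<close>, so the hypothesis on
    \<open>p\<close> implies the weaker rate.\<close>
  have "(\<lambda>N. p N / ln (real N)) \<longlonglongrightarrow> 0"
  proof (rule Lim_null_comparison[OF _ p_small])
    show "eventually (\<lambda>N. norm (p N / ln (real N)) \<le> p N / ln (real N) powr (1 - \<delta>)) sequentially"
      using eventually_ge_at_top[of 3]
    proof eventually_elim
      case (elim N)
      have "1 \<le> ln (real N)"
        using elim exp_le by (subst ln_ge_iff) (auto intro: order_trans[of _ 3])
      moreover from this have "ln (real N) powr (1 - \<delta>) \<le> ln (real N) powr 1"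
        using \<open>0 < \<delta>\<close> by (intro powr_mono) auto
      ultimately show ?case using p[of N] elim by (auto intro!: divide_left_mono mult_pos_pos)
    qed
  qed
  then have "err \<longlonglongrightarrow> 0"
    using no_row_probability_tendsto_0[OF p p_lim] by (simp add: err_def[abs_def] L_def k_def n_def)
  then have "(\<lambda>N. 1 - err N) \<longlonglongrightarrow> 1" by (auto intro: tendsto_eq_intros)
  then have "(\<lambda>N. measure (Ma \<Otimes>\<^sub>M Md N) (G N)) \<longlonglongrightarrow> 1"
  proof (rule tendsto_sandwich[where h = "\<lambda>_. 1", rotated 2])
    show "eventually (\<lambda>N. 1 - err N \<le> measure (Ma \<Otimes>\<^sub>M Md N) (G N)) sequentially"
      by (rule eventually_sequentiallyI[of 1]) (rule lower[THEN conjunct1])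
    show "eventually (\<lambda>N. measure (Ma \<Otimes>\<^sub>M Md N) (G N) \<le> 1) sequentially"
      by (rule eventually_sequentiallyI[of 1]) (rule lower[THEN conjunct2])
  qed simp_all
  then show ?thesis by (simp add: G_def)
qed

end
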